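(* Let $X$ be a separable complete metric space with metric $\rho\le 1$, and let $S(t_0,a)$, $t_0\ge 0$, $a\in X$, be a family of abstract integral funnels on $X$ (as defined in the context). Then for every $t_0\ge 0$ there is a measurable selection $a\mapsto u(\cdot;t_0,a)\in S(t_0,a)$ (that is, the map $X\to\Omega^{t_0}$, $a\mapsto u(\cdot;t_0,a)$, is Borel measurable and $u(\cdot;t_0,a)\in S(t_0,a)$ for every $a\in X$), such that the selections together have the semigroup property $$u(t_0;t_0,a)=a\quad\text{and}\quad u(t_2;t_1,u(t_1;t_0,a))=u(t_2;t_0,a)\qquad \forall a\in X,\ \forall t_2\ge t_1\ge t_0\ge 0.$$ As a corollary, there is a Borel measurable (semi)process $U(t_1,t_0):X\to X$, $t_1\ge t_0\ge 0$, whose orbits are $U(t_1,t_0)(a)=u(t_1;t_0,a)$ for all $t_1\ge t_0\ge 0$ and all $a\in X$.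
   Context: $X$ is a separable complete metric space with metric $\rho$, assumed bounded: $\rho(x,y)\le 1$ for all $x,y\in X$; $\mathcal{B}_X$ is its Borel $\sigma$-algebra. For $\tau\ge 0$, $\Omega^\tau$ denotes the space of continuous maps (paths) $[\tau,+\infty)\to X$ with the compact-open topology (uniform convergence on every compact time interval), equipped with its Borel $\sigma$-algebra; it is a Polish space. For $a\in X$, $\Omega^\tau_a=\{v\in\Omega^\tau: v(\tau)=a\}$. Shift (past erasing): for $u\in\Omega^{t_0}$ and $\tau\ge 0$, $\sigma_\tau u\in\Omega^{t_0+\tau}$ is the restriction of $u$ to $[t_0+\tau,+\infty)$, i.e. $(\sigma_\tau u)(t)=u(t)$ for $t\ge t_0+\tau$. Splicing: for $u\in\Omega^{t_0}$, $t_1\ge t_0$, and $v\in\Omega^{t_1}$ with $v(t_1)=u(t_1)$, the spliced path $w=u\underset{t_1}{\bowtie}v\in\Omega^{t_0}$ is given by $w(t)=u(t)$ for $t_0\le t\le t_1$ and $w(t)=v(t)$ for $t\ge t_1$. A family of abstract integral funnels on $X$ is a family of sets $S(t_0,a)$, $t_0\in[0,+\infty)$, $a\in X$, such that: (S1) For every $t_0\ge 0$ and $a\in X$, $S(t_0,a)$ is a non-empty compact subset of $\Omega^{t_0}_a$. (A path $u\in S(t_0,a)$ is written $u(t;t_0,a)$, $t\ge t_0$.) (S2) For every $t_0\ge 0$ the set-valued map $S(t_0,\cdot)$ is measurable: for every closed set $C\subset\Omega^{t_0}$, $\{x\in X: S(t_0,x)\cap C\ne\emptyset\}\in\mathcal{B}_X$.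 (S3) If $u\in S(t_0,a)$ and $\tau\ge 0$, then $\sigma_\tau u\in S(t_0+\tau,u(t_0+\tau))$. (S4) If $u\in S(t_0,a)$, $\tau\ge 0$ and $v\in S(t_0+\tau,u(t_0+\tau))$, then the spliced path $u\underset{t_0+\tau}{\bowtie}v$ belongs to $S(t_0,a)$. A (semi)process on $X$ is a family of maps $U(t_1,t_0):X\to X$, $t_1\ge t_0\ge 0$, with $U(t,t)=\mathrm{id}_X$ for all $t\ge 0$ and $U(t_2,t_1)\circ U(t_1,t_0)=U(t_2,t_0)$ for all $t_2\ge t_1\ge t_0\ge 0$. It is Borel measurable if each map $U(t_1,t_0)$ is Borel measurable. *)

theory Defs
  imports "HOL-Analysis.Analysis"
begin

text \<open>
  A path on \<open>[\<tau>, \<infinity>)\<close> is a total function that equals \<^const>\<open>undefined\<close> before time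
  \<open>\<tau>\<close>, so that equality of such functions is equality of paths.
\<close>

definition paths :: "real \<Rightarrow> (real \<Rightarrow> 'a::topological_space) set" where
  "paths \<tau> = {v \<in> extensional {\<tau>..}. continuous_on {\<tau>..} v}"

definition paths_from :: "real \<Rightarrow> 'a \<Rightarrow> (real \<Rightarrow> 'a::topological_space) set" where
  "paths_from \<tau> a = {v \<in> paths \<tau>. v \<tau> = a}"

text \<open>The compact-open topology, by its standard subbasis.\<close>

definition path_topology :: "real \<Rightarrow> (real \<Rightarrow> 'a::topological_space) topology" where
  "path_topology \<tau> =
     topology_generated_by {{v \<in> paths \<tau>. v ` K \<subseteq> U} | K U. compact K \<and> K \<subseteq> {\<tau>..} \<and> open U}"

lemma topspace_path_topology [simp]: "topspace (path_topology \<tau>) = paths \<tau>"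
proof -
  have "paths \<tau> = {v \<in> paths \<tau>. v ` {} \<subseteq> (UNIV :: 'a set)}"
    by simp
  then have "(paths \<tau> :: (real \<Rightarrow> 'a) set) \<in>
      {{v \<in> paths \<tau>. v ` K \<subseteq> U} | K U. compact K \<and> K \<subseteq> {\<tau>..} \<and> open U}"
    by blast
  then show ?thesis
    unfolding path_topology_def topology_generated_by_topspace by blast
qed

definition path_borel :: "real \<Rightarrow> (real \<Rightarrow> 'a::topological_space) measure" where
  "path_borel \<tau> = sigma (paths \<tau>) {W. openin (path_topology \<tau>) W}"

lemma openin_path_topology_Pow: "{W. openin (path_topology \<tau>) W} \<subseteq> Pow (paths \<tau>)"
  using openin_subset topspace_path_topology by blast

lemma space_path_borel [simp]: "space (path_borel \<tau>) = paths \<tau>"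
  unfolding path_borel_def by (rule space_measure_of) (rule openin_path_topology_Pow)

lemma sets_path_borel: "sets (path_borel \<tau>) = sigma_sets (paths \<tau>) {W. openin (path_topology \<tau>) W}"
  unfolding path_borel_def by (rule sets_measure_of) (rule openin_path_topology_Pow)

text \<open>The shift \<open>\<sigma>\<^sub>\<tau>\<close> on paths starting at time \<open>t\<^sub>0\<close>; time is not translated.\<close>

definition path_shift :: "real \<Rightarrow> real \<Rightarrow> (real \<Rightarrow> 'a) \<Rightarrow> (real \<Rightarrow> 'a)" where
  "path_shift t\<^sub>0 \<tau> u = restrict u {t\<^sub>0 + \<tau>..}"

definition path_splice :: "real \<Rightarrow> (real \<Rightarrow> 'a) \<Rightarrow> (real \<Rightarrow> 'a) \<Rightarrow> (real \<Rightarrow> 'a)" where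
  "path_splice t\<^sub>1 u v = (\<lambda>t. if t \<le> t\<^sub>1 then u t else v t)"

lemma path_shift_in_paths:
  assumes "u \<in> paths t\<^sub>0" "\<tau> \<ge> 0"
  shows "path_shift t\<^sub>0 \<tau> u \<in> paths (t\<^sub>0 + \<tau>)"
proof -
  have "continuous_on {t\<^sub>0 + \<tau>..} u"
    using assms by (auto simp: paths_def intro: continuous_on_subset)
  then have "continuous_on {t\<^sub>0 + \<tau>..} (restrict u {t\<^sub>0 + \<tau>..})"
    by (subst continuous_on_cong[OF refl, of _ _ u]) auto
  then show ?thesis
    by (simp add: paths_def path_shift_def)
qed

lemma path_splice_in_paths:
  assumes "u \<in> paths t\<^sub>0" "t\<^sub>0 \<le> t\<^sub>1" "v \<in> paths_from t\<^sub>1 (u t\<^sub>1)"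
  shows "path_splice t\<^sub>1 u v \<in> paths t\<^sub>0"
proof -
  have "continuous_on ({t\<^sub>0..t\<^sub>1} \<union> {t\<^sub>1..}) (\<lambda>t. if t \<le> t\<^sub>1 then u t else v t)"
    using assms
    by (intro continuous_on_If) (auto simp: paths_def paths_from_def intro: continuous_on_subset)
  moreover have "{t\<^sub>0..t\<^sub>1} \<union> {t\<^sub>1..} = {t\<^sub>0..}"
    using assms by auto
  ultimately show ?thesis
    using assms by (auto simp: paths_def path_splice_def extensional_def)
qed

text \<open>Only the values \<open>S t\<^sub>0 a\<close> with \<open>t\<^sub>0 \<ge> 0\<close> are constrained.\<close>

locale integral_funnels =
  fixes S :: "real \<Rightarrow> 'a::polish_space \<Rightarrow> (real \<Rightarrow> 'a) set"
  assumes nonempty: "t\<^sub>0 \<ge> 0 \<Longrightarrow> S t\<^sub>0 a \<noteq> {}"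
    and starts: "t\<^sub>0 \<ge> 0 \<Longrightarrow> S t\<^sub>0 a \<subseteq> paths_from t\<^sub>0 a"
    and compact: "t\<^sub>0 \<ge> 0 \<Longrightarrow> compactin (path_topology t\<^sub>0) (S t\<^sub>0 a)"
    and measurable:
      "\<lbrakk>t\<^sub>0 \<ge> 0; closedin (path_topology t\<^sub>0) C\<rbrakk> \<Longrightarrow> {x. S t\<^sub>0 x \<inter> C \<noteq> {}} \<in> sets borel"
    and shift:
      "\<lbrakk>t\<^sub>0 \<ge> 0; u \<in> S t\<^sub>0 a; \<tau> \<ge> 0\<rbrakk> \<Longrightarrow> path_shift t\<^sub>0 \<tau> u \<in> S (t\<^sub>0 + \<tau>) (u (t\<^sub>0 + \<tau>))"
    and splice:
      "\<lbrakk>t\<^sub>0 \<ge> 0; u \<in> S t\<^sub>0 a; \<tau> \<ge> 0; v \<in> S (t\<^sub>0 + \<tau>) (u (t\<^sub>0 + \<tau>))\<rbrakk>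
        \<Longrightarrow> path_splice (t\<^sub>0 + \<tau>) u v \<in> S t\<^sub>0 a"

text \<open>\<open>U t\<^sub>1 t\<^sub>0\<close> is the evolution from time \<open>t\<^sub>0\<close> to the later time \<open>t\<^sub>1\<close>.\<close>

definition semiprocess :: "(real \<Rightarrow> real \<Rightarrow> 'a \<Rightarrow> 'a) \<Rightarrow> bool" where
  "semiprocess U \<longleftrightarrow>
     (\<forall>t\<ge>0. U t t = id) \<and>
     (\<forall>t\<^sub>0 t\<^sub>1 t\<^sub>2. 0 \<le> t\<^sub>0 \<and> t\<^sub>0 \<le> t\<^sub>1 \<and> t\<^sub>1 \<le> t\<^sub>2 \<longrightarrow> U t\<^sub>2 t\<^sub>1 \<circ> U t\<^sub>1 t\<^sub>0 = U t\<^sub>2 t\<^sub>0)"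

definition borel_semiprocess :: "(real \<Rightarrow> real \<Rightarrow> 'a::topological_space \<Rightarrow> 'a) \<Rightarrow> bool" where
  "borel_semiprocess U \<longleftrightarrow>
     semiprocess U \<and> (\<forall>t\<^sub>0 t\<^sub>1. 0 \<le> t\<^sub>0 \<and> t\<^sub>0 \<le> t\<^sub>1 \<longrightarrow> U t\<^sub>1 t\<^sub>0 \<in> borel \<rightarrow>\<^sub>M borel)"

end

theory Submission
  imports Defs
begin

text \<open>
  This is Krylov's selection argument. Fix a continuous \<open>\<phi> : X \<rightarrow> \<real>\<close> and a time \<open>r\<close>, and
  discard from every funnel \<open>S(t\<^sub>0, a)\<close> with \<open>t\<^sub>0 \<le> r\<close> the paths that do not maximise
  \<open>\<phi>(u(r))\<close>. The result is again a family of integral funnels: since the functional looks at a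
  single time, splicing and shifting respect maximality. Doing this successively for all rational
  \<open>r\<close> and all distance functions \<open>\<phi> = \<rho>(\<cdot>, d)\<close>, with \<open>d\<close> in a countable dense set, leaves
  exactly one path in each funnel, and (S3) for the intermediate families is the semigroup
  property.
\<close>

section \<open>Path space: evaluations, separation, measurability\<close>

lemma continuous_map_path_eval:
  fixes r :: real
  assumes "\<tau> \<le> r"
  shows "continuous_map (path_topology \<tau>) (euclidean :: 'a::topological_space topology) (\<lambda>u. u r)"
proof (subst continuous_map, intro conjI allI impI)
  fix U :: "'a set"
  assume "openin euclidean U"
  then have "openin (path_topology \<tau>) {v \<in> paths \<tau>. v ` {r} \<subseteq> U}"
    unfolding path_topology_def using assms
    by (intro topology_generated_by_Basis CollectI exI[of _ "{r}"] exI[of _ U]) simp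
  then show "openin (path_topology \<tau>) {v \<in> topspace (path_topology \<tau>). v r \<in> U}"
    by simp
qed auto

text \<open>Continuity carries the equality from rational to real times. The approximating rationals
  are taken strictly to the right of \<open>t\<close>, so that they stay in the domain even when
  \<open>t = \<tau>\<close>. Before \<open>\<tau>\<close> both functions are
  \<open>undefined\<close>.\<close>

lemma paths_eqI:
  fixes u v :: "real \<Rightarrow> 'a::t2_space"
  assumes "u \<in> paths \<tau>" "v \<in> paths \<tau>"
    and eq: "\<And>r. \<lbrakk>r \<in> \<rat>; \<tau> \<le> r\<rbrakk> \<Longrightarrow> u r = v r"
  shows "u = v"
proof
  fix t
  show "u t = v t"
  proof (cases "\<tau> \<le> t")
    case True
    have "\<exists>q\<in>\<rat>. t < q \<and> q < t + inverse (real (Suc n))" for n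
      by (rule Rats_dense_in_real) simp
    then obtain s where s: "\<And>n. s n \<in> \<rat>" "\<And>n. t < s n" "\<And>n. s n < t + inverse (real (Suc n))"
      by metis
    have "s \<longlonglongrightarrow> t"
    proof (rule tendsto_sandwich[OF _ _ tendsto_const LIMSEQ_inverse_real_of_nat_add[of t]])
      show "\<forall>\<^sub>F n in sequentially. t \<le> s n"
        using s(2) by (simp add: less_imp_le)
      show "\<forall>\<^sub>F n in sequentially. s n \<le> t + inverse (real (Suc n))"
        using s(3) by (intro always_eventually allI less_imp_le)
    qed
    have lim: "(\<lambda>n. w (s n)) \<longlonglongrightarrow> w t" if "w \<in> paths \<tau>" for w :: "real \<Rightarrow> 'a"
    proof (rule continuous_on_tendsto_compose[of "{\<tau>..}" w])
      show "\<forall>\<^sub>F n in sequentially. s n \<in> {\<tau>..}"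
        using s(2) True by (intro always_eventually) (simp add: less_imp_le order_le_less_trans)
    qed (use that \<open>s \<longlonglongrightarrow> t\<close> True in \<open>simp_all add: paths_def\<close>)
    moreover have "(\<lambda>n. u (s n)) = (\<lambda>n. v (s n))"
      using s(1,2) eq True by (metis less_imp_le order_trans)
    ultimately show ?thesis
      using assms(1,2) by (metis LIMSEQ_unique)
  next
    case False
    then show ?thesis
      using assms(1,2) by (simp add: paths_def extensional_def)
  qed
qed

text \<open>Distinct paths differ at some time of their domain, and evaluation there pulls back
  disjoint neighbourhoods. This is what makes compact funnels closed in the nested intersection
  argument below.\<close>

lemma Hausdorff_space_path_topology:
  "Hausdorff_space (path_topology \<tau> :: (real \<Rightarrow> 'a::t2_space) topology)"
  unfolding Hausdorff_space_def
proof (intro allI impI)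
  fix u v :: "real \<Rightarrow> 'a"
  assume uv: "u \<in> topspace (path_topology \<tau>) \<and> v \<in> topspace (path_topology \<tau>) \<and> u \<noteq> v"
  then obtain r where r: "\<tau> \<le> r" "u r \<noteq> v r"
    using paths_eqI[of u \<tau> v] by auto
  then obtain A B where AB: "open A" "open B" "u r \<in> A" "v r \<in> B" "A \<inter> B = {}"
    by (meson hausdorff)
  let ?P = "\<lambda>A. {w \<in> topspace (path_topology \<tau>). w r \<in> A}"
  have "openin (path_topology \<tau>) (?P A)" "openin (path_topology \<tau>) (?P B)"
    using AB by (auto intro!: openin_continuous_map_preimage[OF continuous_map_path_eval[OF r(1)]]
        simp del: topspace_path_topology)
  moreover have "u \<in> ?P A" "v \<in> ?P B" "disjnt (?P A) (?P B)"
    using uv AB by (auto simp: disjnt_def)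
  ultimately show "\<exists>U V. openin (path_topology \<tau>) U \<and> openin (path_topology \<tau>) V \<and>
      u \<in> U \<and> v \<in> V \<and> disjnt U V"
    by blast
qed

lemma eval_measurable_path_borel:
  assumes "\<tau> \<le> r"
  shows "(\<lambda>u. u r) \<in> path_borel \<tau> \<rightarrow>\<^sub>M (borel :: 'a::topological_space measure)"
proof (rule borel_measurableI)
  fix U :: "'a set"
  assume "open U"
  then have "openin (path_topology \<tau>) {w \<in> topspace (path_topology \<tau>). w r \<in> U}"
    by (intro openin_continuous_map_preimage[OF continuous_map_path_eval[OF assms]]) simp
  moreover have "(\<lambda>u. u r) -` U \<inter> space (path_borel \<tau>) =
      {w \<in> topspace (path_topology \<tau>). w r \<in> U}"
    by auto
  ultimately show "(\<lambda>u. u r) -` U \<inter> space (path_borel \<tau>) \<in> sets (path_borel \<tau>)"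
    by (auto simp: sets_path_borel)
qed

text \<open>Complements lead from closed sets to the open generators. Closed test sets suit the
  funnels, whose measurability is stated for closed sets.\<close>

lemma measurable_path_borelI:
  fixes f :: "'a \<Rightarrow> real \<Rightarrow> 'b::topological_space"
  assumes "\<And>x. x \<in> space M \<Longrightarrow> f x \<in> paths \<tau>"
    and closed: "\<And>C. closedin (path_topology \<tau>) C \<Longrightarrow> {x \<in> space M. f x \<in> C} \<in> sets M"
  shows "f \<in> M \<rightarrow>\<^sub>M path_borel \<tau>"
  unfolding path_borel_def
proof (rule measurable_measure_of)
  fix W :: "(real \<Rightarrow> 'b) set"
  assume "W \<in> {W. openin (path_topology \<tau>) W}"
  then have "closedin (path_topology \<tau>) (paths \<tau> - W)"
    using closedin_diff[OF closedin_topspace, of "path_topology \<tau>" W] by simp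
  then have "space M - {x \<in> space M. f x \<in> paths \<tau> - W} \<in> sets M"
    by (intro sets.compl_sets closed)
  moreover have "space M - {x \<in> space M. f x \<in> paths \<tau> - W} = f -` W \<inter> space M"
    using assms(1) by auto
  ultimately show "f -` W \<inter> space M \<in> sets M"
    by simp
qed (use assms(1) openin_path_topology_Pow in auto)

section \<open>Maximisers of a continuous function on a compact set\<close>

lemma compactin_attains_sup:
  fixes f :: "'a \<Rightarrow> real"
  assumes "compactin X K" "K \<noteq> {}" "continuous_map X euclideanreal f"
  obtains u where "u \<in> K" "\<And>v. v \<in> K \<Longrightarrow> f v \<le> f u"
proof -
  have "compact (f ` K)"
    using image_compactin[OF assms(1,3)] by simp
  then show thesis
    using compact_attains_sup[of "f ` K"] assms(2) that by auto
qed

lemma closedin_superlevel: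
  fixes f :: "'a \<Rightarrow> real"
  assumes "continuous_map X euclideanreal f"
  shows "closedin X {u \<in> topspace X. q \<le> f u}"
  using closedin_continuous_map_preimage[OF assms, of "{q..}"] by simp

text \<open>The maximum over \<open>K \<inter> C\<close> falls short of that over \<open>K\<close>
  only if some rational level is reached on \<open>K\<close> but not on \<open>K \<inter> C\<close>.
  Rational levels turn the comparison of two maxima into countably many conditions that
  \<open>K\<close> meets a closed set, which is the form measurability needs.\<close>

lemma argmax_meets_closedin_iff:
  fixes f :: "'a \<Rightarrow> real"
  assumes K: "compactin X K" and C: "closedin X C" and f: "continuous_map X euclideanreal f"
  shows "{u \<in> K. \<forall>v\<in>K. f v \<le> f u} \<inter> C \<noteq> {} \<longleftrightarrow>
    K \<inter> C \<noteq> {} \<and>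
    (\<forall>q\<in>\<rat>. K \<inter> {u \<in> topspace X. q \<le> f u} \<noteq> {} \<longrightarrow>
      K \<inter> (C \<inter> {u \<in> topspace X. q \<le> f u}) \<noteq> {})"
    (is "?lhs \<longleftrightarrow> ?ne \<and> ?rat")
proof
  assume ?lhs
  then obtain u where u: "u \<in> K" "u \<in> C" "\<And>v. v \<in> K \<Longrightarrow> f v \<le> f u"
    by auto
  moreover have "u \<in> topspace X"
    using u K compactin_subset_topspace by blast
  ultimately show "?ne \<and> ?rat"
    by (auto simp: set_eq_iff intro: order_trans)
next
  assume R: "?ne \<and> ?rat"
  obtain u where u: "u \<in> K \<inter> C" "\<And>v. v \<in> K \<inter> C \<Longrightarrow> f v \<le> f u"
    using compactin_attains_sup[OF compact_Int_closedin[OF K C] _ f] R by blast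
  have "f v \<le> f u" if "v \<in> K" for v
  proof (rule ccontr)
    assume "\<not> f v \<le> f u"
    then obtain q where q: "q \<in> \<rat>" "f u < q" "q < f v"
      using Rats_dense_in_real[of "f u" "f v"] by auto
    then have "K \<inter> {w \<in> topspace X. q \<le> f w} \<noteq> {}"
      using that K compactin_subset_topspace by fastforce
    then obtain w where "w \<in> K \<inter> C" "q \<le> f w"
      using R q(1) by blast
    then show False
      using u(2) q(2) by fastforce
  qed
  then show ?lhs
    using u by blast
qed

section \<open>One refinement step\<close>

text \<open>Funnels with \<open>r < t\<^sub>0\<close> are kept whole, since their paths have no
  meaningful value at time \<open>r\<close>.\<close>

definition refine ::
    "real \<Rightarrow> ('a \<Rightarrow> real) \<Rightarrow> (real \<Rightarrow> 'a \<Rightarrow> (real \<Rightarrow> 'a) set) \<Rightarrow> real \<Rightarrow> 'a \<Rightarrow> (real \<Rightarrow> 'a) set" where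
  "refine r \<phi> S t\<^sub>0 a = {u \<in> S t\<^sub>0 a. t\<^sub>0 \<le> r \<longrightarrow> (\<forall>v\<in>S t\<^sub>0 a. \<phi> (v r) \<le> \<phi> (u r))}"

lemma integral_funnels_refine:
  fixes S :: "real \<Rightarrow> 'a::polish_space \<Rightarrow> (real \<Rightarrow> 'a) set"
  assumes "integral_funnels S" and \<phi>: "continuous_on UNIV \<phi>"
  shows "integral_funnels (refine r \<phi> S)"
proof -
  interpret integral_funnels S by fact
  have cont: "continuous_map (path_topology t\<^sub>0) euclideanreal (\<lambda>u. \<phi> (u r))" if "t\<^sub>0 \<le> r" for t\<^sub>0
    using continuous_map_compose[OF continuous_map_path_eval[OF that], of euclideanreal \<phi>] \<phi>
    by (simp add: o_def)
  have argmax: "refine r \<phi> S t\<^sub>0 a = {u \<in> S t\<^sub>0 a. \<forall>v\<in>S t\<^sub>0 a. \<phi> (v r) \<le> \<phi> (u r)}"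
    if "t\<^sub>0 \<le> r" for t\<^sub>0 a
    using that by (simp add: refine_def)
  have all: "refine r \<phi> S t\<^sub>0 a = S t\<^sub>0 a" if "\<not> t\<^sub>0 \<le> r" for t\<^sub>0 a
    using that by (simp add: refine_def)
  show ?thesis
  proof
    fix t\<^sub>0 :: real and a
    assume t0: "0 \<le> t\<^sub>0"
    show "refine r \<phi> S t\<^sub>0 a \<subseteq> paths_from t\<^sub>0 a"
      using starts[OF t0] by (auto simp: refine_def)
    show "refine r \<phi> S t\<^sub>0 a \<noteq> {}"
    proof (cases "t\<^sub>0 \<le> r")
      case True
      obtain u where "u \<in> S t\<^sub>0 a" "\<And>v. v \<in> S t\<^sub>0 a \<Longrightarrow> \<phi> (v r) \<le> \<phi> (u r)"
        using compactin_attains_sup[OF compact[OF t0] nonempty[OF t0] cont[OF True]] by blast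
      then show ?thesis
        using argmax[OF True] by blast
    qed (simp add: all nonempty t0)
    show "compactin (path_topology t\<^sub>0) (refine r \<phi> S t\<^sub>0 a)"
    proof (cases "t\<^sub>0 \<le> r")
      case True
      obtain u where u: "u \<in> S t\<^sub>0 a" "\<And>v. v \<in> S t\<^sub>0 a \<Longrightarrow> \<phi> (v r) \<le> \<phi> (u r)"
        using compactin_attains_sup[OF compact[OF t0] nonempty[OF t0] cont[OF True]] by blast
      \<comment> \<open>The maximisers form the closed superlevel set at the maximal value, cut out
        of a compact funnel.\<close>
      have "refine r \<phi> S t\<^sub>0 a =
          S t\<^sub>0 a \<inter> {v \<in> topspace (path_topology t\<^sub>0). \<phi> (u r) \<le> \<phi> (v r)}"
      proof (intro set_eqI iffI)
        fix w
        assume "w \<in> S t\<^sub>0 a \<inter> {v \<in> topspace (path_topology t\<^sub>0). \<phi> (u r) \<le> \<phi> (v r)}"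
        then have "w \<in> S t\<^sub>0 a" "\<phi> (u r) \<le> \<phi> (w r)"
          by auto
        then show "w \<in> refine r \<phi> S t\<^sub>0 a"
          using order_trans[OF u(2)] by (simp add: refine_def)
      qed (use u starts[OF t0] argmax[OF True] in \<open>auto simp: paths_from_def\<close>)
      then show ?thesis
        using compact_Int_closedin[OF compact[OF t0] closedin_superlevel[OF cont[OF True]]] by simp
    qed (simp add: all compact t0)
  next
    fix t\<^sub>0 :: real and C :: "(real \<Rightarrow> 'a) set"
    assume t0: "0 \<le> t\<^sub>0" and C: "closedin (path_topology t\<^sub>0) C"
    show "{x. refine r \<phi> S t\<^sub>0 x \<inter> C \<noteq> {}} \<in> sets borel"
    proof (cases "t\<^sub>0 \<le> r")
      case True
      define A where "A q = {u \<in> topspace (path_topology t\<^sub>0). q \<le> \<phi> (u r)}" for q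
      define hit where "hit D = {x. S t\<^sub>0 x \<inter> D \<noteq> {}}" for D
      have hit: "hit D \<in> sets borel" if "closedin (path_topology t\<^sub>0) D" for D
        using measurable[OF t0 that] by (simp add: hit_def)
      have A: "closedin (path_topology t\<^sub>0) (A q)" for q
        unfolding A_def by (rule closedin_superlevel[OF cont[OF True]])
      \<comment> \<open>The rational criterion, read as a function of \<open>x\<close>, is a
        countable Boolean combination of the Borel sets \<open>hit D\<close> with \<open>D\<close>
        closed.\<close>
      have "{x. refine r \<phi> S t\<^sub>0 x \<inter> C \<noteq> {}} =
          hit C \<inter> (\<Inter>q\<in>\<rat>. (space borel - hit (A q)) \<union> hit (C \<inter> A q))"
        unfolding argmax[OF True] hit_def A_def
          argmax_meets_closedin_iff[OF compact[OF t0] C cont[OF True]]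
        by auto
      also have "\<dots> \<in> sets borel"
      proof (intro sets.Int sets.countable_INT' hit C)
        have "(space borel - hit (A q)) \<union> hit (C \<inter> A q) \<in> sets borel" for q
          by (intro sets.Un sets.compl_sets hit A C closedin_Int)
        then show "(\<lambda>q. (space borel - hit (A q)) \<union> hit (C \<inter> A q)) ` \<rat> \<subseteq> sets borel"
          by blast
      qed (use countable_rat Rats_0 in auto)
      finally show ?thesis .
    qed (simp add: all measurable t0 C)
  next
    fix t\<^sub>0 :: real and u a and \<tau> :: real
    assume t0: "0 \<le> t\<^sub>0" and u: "u \<in> refine r \<phi> S t\<^sub>0 a" and \<tau>: "0 \<le> \<tau>"
    have uS: "u \<in> S t\<^sub>0 a"
      using u by (simp add: refine_def)
    have shift_u: "path_shift t\<^sub>0 \<tau> u \<in> S (t\<^sub>0 + \<tau>) (u (t\<^sub>0 + \<tau>))"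
      by (rule shift[OF t0 uS \<tau>])
    show "path_shift t\<^sub>0 \<tau> u \<in> refine r \<phi> S (t\<^sub>0 + \<tau>) (u (t\<^sub>0 + \<tau>))"
    proof -
      \<comment> \<open>A competitor \<open>v\<close> of the shifted path, spliced onto
        \<open>u\<close>, is a competitor of \<open>u\<close> itself, and \<open>u\<close> is
        maximal.\<close>
      have "\<phi> (v r) \<le> \<phi> (path_shift t\<^sub>0 \<tau> u r)"
        if r: "t\<^sub>0 + \<tau> \<le> r" and v: "v \<in> S (t\<^sub>0 + \<tau>) (u (t\<^sub>0 + \<tau>))" for v
      proof -
        \<comment> \<open>Needed for \<open>r = t\<^sub>0 + \<tau>\<close>, where the splice takes
          its value from \<open>u\<close>.\<close>
        have "v (t\<^sub>0 + \<tau>) = u (t\<^sub>0 + \<tau>)"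
          using starts[of "t\<^sub>0 + \<tau>"] t0 \<tau> v by (auto simp: paths_from_def)
        then have "path_splice (t\<^sub>0 + \<tau>) u v r = v r"
          using r by (auto simp: path_splice_def)
        then show ?thesis
          using splice[OF t0 uS \<tau> v] u r \<tau> by (auto simp: refine_def path_shift_def dest: bspec)
      qed
      then show ?thesis
        using shift_u by (simp add: refine_def)
    qed
    fix v
    assume v: "v \<in> refine r \<phi> S (t\<^sub>0 + \<tau>) (u (t\<^sub>0 + \<tau>))"
    have vS: "v \<in> S (t\<^sub>0 + \<tau>) (u (t\<^sub>0 + \<tau>))"
      using v by (simp add: refine_def)
    \<comment> \<open>Up to the splicing time the spliced path is \<open>u\<close>. After it,
      \<open>v\<close> does at least as well as the shift of \<open>u\<close>, which lies in the
      same funnel. A path at least as good as the maximal \<open>u\<close> is maximal.\<close>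
    have "\<phi> (u r) \<le> \<phi> (path_splice (t\<^sub>0 + \<tau>) u v r)"
    proof (cases "r \<le> t\<^sub>0 + \<tau>")
      case False
      then have "\<phi> (path_shift t\<^sub>0 \<tau> u r) \<le> \<phi> (v r)"
        using v shift_u by (simp add: refine_def)
      then show ?thesis
        using False by (simp add: path_shift_def path_splice_def)
    qed (simp add: path_splice_def)
    then show "path_splice (t\<^sub>0 + \<tau>) u v \<in> refine r \<phi> S t\<^sub>0 a"
      using splice[OF t0 uS \<tau> vS] u by (auto simp: refine_def intro: order_trans[of _ "\<phi> (u r)"])
  qed
qed

section \<open>Iterated refinement\<close>

text \<open>A point \<open>d\<close> closer to \<open>x\<close> than half of \<open>dist x y\<close>
  would be equally close to \<open>y\<close>, against the triangle inequality.\<close>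

lemma dense_dist_eqI:
  fixes x y :: "'a::metric_space"
  assumes dense: "\<And>U. \<lbrakk>open U; U \<noteq> {}\<rbrakk> \<Longrightarrow> \<exists>d\<in>D. d \<in> U"
    and eq: "\<And>d. d \<in> D \<Longrightarrow> dist x d = dist y d"
  shows "x = y"
proof (rule ccontr)
  assume "x \<noteq> y"
  then obtain d where "d \<in> D" "d \<in> ball x (dist x y / 2)"
    using dense[of "ball x (dist x y / 2)"] by auto
  then show False
    using eq[of d] dist_triangle2[of x y d] by simp
qed

primrec krylov :: "(nat \<Rightarrow> real \<times> 'a::metric_space) \<Rightarrow> (real \<Rightarrow> 'a \<Rightarrow> (real \<Rightarrow> 'a) set)
    \<Rightarrow> nat \<Rightarrow> real \<Rightarrow> 'a \<Rightarrow> (real \<Rightarrow> 'a) set" where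
  "krylov e S 0 = S"
| "krylov e S (Suc n) = refine (fst (e n)) (\<lambda>x. dist x (snd (e n))) (krylov e S n)"

lemma integral_funnels_krylov:
  assumes "integral_funnels S"
  shows "integral_funnels (krylov e S n)"
proof (induction n)
  case (Suc n)
  have "continuous_on UNIV (\<lambda>x. dist x (snd (e n)))"
    by (intro continuous_intros)
  then show ?case
    using integral_funnels_refine[OF Suc.IH] by simp
qed (simp add: assms)

lemma decseq_krylov: "decseq (\<lambda>n. krylov e S n t\<^sub>0 a)"
  by (rule decseq_SucI) (auto simp: refine_def)

text \<open>Cantor's intersection theorem inside the compact space \<open>S t\<^sub>0 a\<close>.
  With \<open>C\<close> the whole space it gives a path surviving all stages; general
  \<open>C\<close> is used for the measurability of the selection.\<close>

lemma krylov_meets_closedin: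
  assumes S: "integral_funnels S" and t0: "0 \<le> t\<^sub>0" and C: "closedin (path_topology t\<^sub>0) C"
    and ne: "\<And>n. krylov e S n t\<^sub>0 a \<inter> C \<noteq> {}"
  shows "(\<Inter>n. krylov e S n t\<^sub>0 a) \<inter> C \<noteq> {}"
proof -
  let ?K = "\<lambda>n. krylov e S n t\<^sub>0 a" and ?X = "subtopology (path_topology t\<^sub>0) (S t\<^sub>0 a)"
  have comp: "compactin (path_topology t\<^sub>0) (?K n)" for n
    by (rule integral_funnels.compact[OF integral_funnels_krylov[OF S] t0])
  have "closedin ?X (?K n \<inter> C)" for n
  proof (rule closedin_subset_topspace)
    show "closedin (path_topology t\<^sub>0) (?K n \<inter> C)"
      by (intro closedin_Int C compactin_imp_closedin Hausdorff_space_path_topology comp)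
    show "?K n \<inter> C \<subseteq> S t\<^sub>0 a"
      using decseqD[OF decseq_krylov, of 0 n e S t\<^sub>0 a] by auto
  qed
  moreover have "compact_space ?X"
    using comp[of 0] by (simp add: compactin_subspace)
  moreover have "decseq (\<lambda>n. ?K n \<inter> C)"
    using decseq_krylov[of e S t\<^sub>0 a] by (fastforce simp: decseq_def)
  ultimately have "(\<Inter>n. ?K n \<inter> C) \<noteq> {}"
    using ne by (intro compact_space_imp_nest) auto
  then show ?thesis
    by auto
qed

text \<open>If \<open>e n = (r, d)\<close>, both paths lie in stage \<open>n\<close> and both
  maximise the distance to \<open>d\<close> at time \<open>r\<close> there, so these distances
  agree. Letting \<open>d\<close> and then \<open>r\<close> vary determines the path.\<close>

lemma krylov_unique:
  assumes S: "integral_funnels S" and t0: "0 \<le> t\<^sub>0"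
    and dense: "\<And>U. \<lbrakk>open U; U \<noteq> {}\<rbrakk> \<Longrightarrow> \<exists>d\<in>D. d \<in> U"
    and e: "range e = \<rat> \<times> D"
    and u: "\<And>n. u \<in> krylov e S n t\<^sub>0 a" and v: "\<And>n. v \<in> krylov e S n t\<^sub>0 a"
  shows "u = v"
proof (rule paths_eqI)
  show "u \<in> paths t\<^sub>0" "v \<in> paths t\<^sub>0"
    using integral_funnels.starts[OF S t0] u[of 0] v[of 0] by (auto simp: paths_from_def)
  fix r :: real
  assume r: "r \<in> \<rat>" "t\<^sub>0 \<le> r"
  show "u r = v r"
  proof (rule dense_dist_eqI[OF dense])
    fix d
    assume "d \<in> D"
    then obtain n where "e n = (r, d)"
      using e r(1) by (metis SigmaI imageE)
    then show "dist (u r) d = dist (v r) d"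
      using u[of "Suc n"] v[of "Suc n"] r(2) by (auto simp: refine_def intro: antisym)
  qed
qed

section \<open>The selection and its semiprocess\<close>

theorem theorem1:
  fixes S :: "real \<Rightarrow> 'a::polish_space \<Rightarrow> (real \<Rightarrow> 'a) set"
  assumes "\<And>x y :: 'a. dist x y \<le> 1"
    and "integral_funnels S"
  shows "\<exists>u :: real \<Rightarrow> 'a \<Rightarrow> real \<Rightarrow> 'a.
    (\<forall>t\<^sub>0\<ge>0. u t\<^sub>0 \<in> borel \<rightarrow>\<^sub>M path_borel t\<^sub>0 \<and> (\<forall>a. u t\<^sub>0 a \<in> S t\<^sub>0 a)) \<and>
    (\<forall>a t\<^sub>0. 0 \<le> t\<^sub>0 \<longrightarrow> u t\<^sub>0 a t\<^sub>0 = a) \<and>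
    (\<forall>a t\<^sub>0 t\<^sub>1 t\<^sub>2. 0 \<le> t\<^sub>0 \<and> t\<^sub>0 \<le> t\<^sub>1 \<and> t\<^sub>1 \<le> t\<^sub>2 \<longrightarrow> u t\<^sub>1 (u t\<^sub>0 a t\<^sub>1) t\<^sub>2 = u t\<^sub>0 a t\<^sub>2) \<and>
    (\<exists>U. borel_semiprocess U \<and>
      (\<forall>a t\<^sub>0 t\<^sub>1. 0 \<le> t\<^sub>0 \<and> t\<^sub>0 \<le> t\<^sub>1 \<longrightarrow> U t\<^sub>1 t\<^sub>0 a = u t\<^sub>0 a t\<^sub>1))"
proof -
  obtain D :: "'a set" where D: "countable D" "\<And>U. \<lbrakk>open U; U \<noteq> {}\<rbrakk> \<Longrightarrow> \<exists>d\<in>D. d \<in> U"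
    using countable_dense_exists by metis
  define e where "e = from_nat_into ((\<rat> :: real set) \<times> D)"
  have e: "range e = \<rat> \<times> D"
    \<comment> \<open>\<open>D\<close> meets \<open>UNIV\<close>, so the set to be enumerated is
      nonempty.\<close>
    unfolding e_def using D(1) D(2)[of UNIV] countable_rat Rats_0
    by (intro range_from_nat_into) auto
  define T where "T = krylov e S"
  have T: "integral_funnels (T n)" for n
    unfolding T_def by (rule integral_funnels_krylov) fact
  have T_subset: "T n t\<^sub>0 a \<subseteq> S t\<^sub>0 a" for n t\<^sub>0 a
    using decseqD[OF decseq_krylov, of 0 n e S t\<^sub>0 a] by (simp add: T_def)
  \<comment> \<open>For \<open>t\<^sub>0 \<ge> 0\<close> exactly one path survives all stages, as
    \<open>u_in\<close> and \<open>u_eq\<close> show, so \<open>SOME\<close> makes no real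
    choice.\<close>
  define u where "u t\<^sub>0 a = (SOME v. \<forall>n. v \<in> T n t\<^sub>0 a)" for t\<^sub>0 a
  have meets: "\<exists>v\<in>C. \<forall>n. v \<in> T n t\<^sub>0 a"
    if "0 \<le> t\<^sub>0" "closedin (path_topology t\<^sub>0) C" "\<And>n. T n t\<^sub>0 a \<inter> C \<noteq> {}" for t\<^sub>0 a C
    using krylov_meets_closedin[OF assms(2) that(1,2), of e a] that(3) by (auto simp: T_def)
  have u_in: "u t\<^sub>0 a \<in> T n t\<^sub>0 a" if "0 \<le> t\<^sub>0" for t\<^sub>0 a n
  proof -
    have "T n t\<^sub>0 a \<inter> topspace (path_topology t\<^sub>0) \<noteq> {}" for n
      using integral_funnels.nonempty[OF T that] integral_funnels.starts[OF T that]
      by (fastforce simp: paths_from_def)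
    then have "\<exists>v. \<forall>n. v \<in> T n t\<^sub>0 a"
      using meets[OF that closedin_topspace] by blast
    then show ?thesis
      unfolding u_def by (rule someI2_ex) blast
  qed
  have u_eq: "v = u t\<^sub>0 a" if "0 \<le> t\<^sub>0" "\<And>n. v \<in> T n t\<^sub>0 a" for t\<^sub>0 a v
    using krylov_unique[OF assms(2) that(1) D(2) e] that u_in unfolding T_def by blast
  have u_S: "u t\<^sub>0 a \<in> S t\<^sub>0 a" if "0 \<le> t\<^sub>0" for t\<^sub>0 a
    using u_in[OF that] T_subset by blast
  have u_paths: "u t\<^sub>0 a \<in> paths_from t\<^sub>0 a" if "0 \<le> t\<^sub>0" for t\<^sub>0 a
    using u_S[OF that] integral_funnels.starts[OF assms(2) that] by blast
  have start: "u t\<^sub>0 a t\<^sub>0 = a" if "0 \<le> t\<^sub>0" for t\<^sub>0 a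
    using u_paths[OF that] by (simp add: paths_from_def)
  have meas: "u t\<^sub>0 \<in> borel \<rightarrow>\<^sub>M path_borel t\<^sub>0" if t0: "0 \<le> t\<^sub>0" for t\<^sub>0
  proof (rule measurable_path_borelI)
    fix C :: "(real \<Rightarrow> 'a) set"
    assume C: "closedin (path_topology t\<^sub>0) C"
    \<comment> \<open>If every stage meets \<open>C\<close>, compactness yields a surviving path in
      \<open>C\<close>, and by uniqueness it is \<open>u t\<^sub>0 x\<close>.\<close>
    have "{x \<in> space borel. u t\<^sub>0 x \<in> C} = (\<Inter>n. {x. T n t\<^sub>0 x \<inter> C \<noteq> {}})"
    proof (intro set_eqI iffI)
      fix x
      assume "x \<in> (\<Inter>n. {x. T n t\<^sub>0 x \<inter> C \<noteq> {}})"
      then obtain v where "v \<in> C" "\<And>n. v \<in> T n t\<^sub>0 x"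
        using meets[OF t0 C, of x] by blast
      then show "x \<in> {x \<in> space borel. u t\<^sub>0 x \<in> C}"
        using u_eq[OF t0] by auto
    qed (use u_in[OF t0] in auto)
    then show "{x \<in> space borel. u t\<^sub>0 x \<in> C} \<in> sets borel"
      using integral_funnels.measurable[OF T t0 C] by auto
  qed (use u_paths[OF t0] in \<open>simp add: paths_from_def\<close>)
  have semigroup: "u t\<^sub>1 (u t\<^sub>0 a t\<^sub>1) t\<^sub>2 = u t\<^sub>0 a t\<^sub>2" if "0 \<le> t\<^sub>0" "t\<^sub>0 \<le> t\<^sub>1" "t\<^sub>1 \<le> t\<^sub>2" for a t\<^sub>0 t\<^sub>1 t\<^sub>2
  proof -
    \<comment> \<open>Every stage is itself a family of funnels, so the shifted path survives all
      stages from its new starting point, and uniqueness identifies it.\<close>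
    have "path_shift t\<^sub>0 (t\<^sub>1 - t\<^sub>0) (u t\<^sub>0 a) \<in> T n t\<^sub>1 (u t\<^sub>0 a t\<^sub>1)" for n
      using integral_funnels.shift[OF T that(1) u_in[OF that(1)], of "t\<^sub>1 - t\<^sub>0"] that by simp
    then have "u t\<^sub>1 (u t\<^sub>0 a t\<^sub>1) = path_shift t\<^sub>0 (t\<^sub>1 - t\<^sub>0) (u t\<^sub>0 a)"
      using that by (intro u_eq[symmetric]) auto
    then show ?thesis
      using that by (simp add: path_shift_def)
  qed
  have eval_meas: "(\<lambda>a. u t\<^sub>0 a t\<^sub>1) \<in> borel \<rightarrow>\<^sub>M borel" if "0 \<le> t\<^sub>0" "t\<^sub>0 \<le> t\<^sub>1" for t\<^sub>0 t\<^sub>1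
    by (rule measurable_compose[OF meas eval_measurable_path_borel]) (use that in auto)
  have "borel_semiprocess (\<lambda>t\<^sub>1 t\<^sub>0 a. u t\<^sub>0 a t\<^sub>1)"
    unfolding borel_semiprocess_def semiprocess_def
    using eval_meas semigroup start by (auto simp: fun_eq_iff)
  then show ?thesis
    using meas u_S start semigroup by (intro exI[of _ u]) blast
qed

end
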